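(* Let $p$ and $q$ be odd primes with $q=p+2$ and let $N=pq$. Let $\{s_i\}_{i=0}^{N-1}$ be the Ding-Helleseth generalized cyclotomic sequence of period $N$ defined by $s_i=1$ if $i \bmod N\in D_1^{(N)}\cup Q$, and $s_i=0$ if $i\bmod N\in D_0^{(N)}\cup P\cup\{0\}$. Then the $2$-adic complexity of $\{s_i\}_{i=0}^{N-1}$ is $$\Phi_2(s)=N-1.$$
   Context: Setting: $p<q$ are distinct odd primes with $\gcd(p-1,q-1)=2$ (automatic when $q=p+2$), $N=pq$, and $e=\frac{(p-1)(q-1)}{2}$. Let $g$ be a common primitive root modulo both $p$ and $q$ (it exists by the Chinese Remainder Theorem), and let $x$ be an integer with $x\equiv g\pmod p$ and $x\equiv 1\pmod q$. Write $Z_N$ for the ring of integers modulo $N$ and $Z_N^{*}$ for its group of units. The Ding-Helleseth generalized cyclotomic classes of order $2$ are the following subsets of $Z_N^{*}$ (elements taken modulo $N$): $$D_0^{(N)}=\{g^{2t}x^i: t=0,1,\dots,\tfrac e2-1;\ i=0,1\},\qquad D_1^{(N)}=gD_0^{(N)}.$$ Then $Z_N^{*}$ is the disjoint union of $D_0^{(N)}$ and $D_1^{(N)}$. Put $P=\{p,2p,\dots,(q-1)p\}$ and $Q=\{q,2q,\dots,(p-1)q\}$, so that $D_0^{(N)},D_1^{(N)},P,Q,\{0\}$ partition $Z_N$. $2$-adic complexity: for a binary sequence $\{s_i\}_{i=0}^{N-1}$ of period $N$ (entries in $\{0,1\}$ viewed as integers), let $S(X)=\sum_{i=0}^{N-1}s_iX^i\in\mathbb{Z}[X]$.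 Its $2$-adic complexity is $$\Phi_2(s)=\left\lfloor \log_2\frac{2^N-1}{\gcd(2^N-1,S(2))}\right\rfloor .$$ *)

theory Defs
  imports Complex_Main "HOL-Computational_Algebra.Polynomial" "HOL-Number_Theory.Number_Theory"
begin

text \<open>
  The library predicate \<open>residue_primroot\<close> takes a natural number; an integer is a primitive
  root iff its least non-negative residue is one.
\<close>

definition int_primroot :: "nat \<Rightarrow> int \<Rightarrow> bool" where
  "int_primroot n g \<longleftrightarrow> residue_primroot n (nat (g mod int n))"

text \<open>
  The residue ring modulo \<open>N = p * q\<close> is represented by the integers \<open>0, \<dots>, N - 1\<close>.  For distinct
  odd primes both divisions in \<open>dh_e p q div 2\<close> are exact.
\<close>

definition dh_e :: "nat \<Rightarrow> nat \<Rightarrow> nat" where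
  "dh_e p q = (p - 1) * (q - 1) div 2"

definition dh_D0 :: "nat \<Rightarrow> nat \<Rightarrow> int \<Rightarrow> int \<Rightarrow> int set" where
  "dh_D0 p q g x =
     {(g ^ (2 * t) * x ^ i) mod int (p * q) | t i. t < dh_e p q div 2 \<and> i \<in> {0, 1}}"

definition dh_D1 :: "nat \<Rightarrow> nat \<Rightarrow> int \<Rightarrow> int \<Rightarrow> int set" where
  "dh_D1 p q g x = (\<lambda>d. (g * d) mod int (p * q)) ` dh_D0 p q g x"

definition dh_P :: "nat \<Rightarrow> nat \<Rightarrow> int set" where
  "dh_P p q = (\<lambda>k. int (k * p)) ` {1..q - 1}"

definition dh_Q :: "nat \<Rightarrow> nat \<Rightarrow> int set" where
  "dh_Q p q = (\<lambda>k. int (k * q)) ` {1..p - 1}"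

definition seq_poly :: "nat \<Rightarrow> (nat \<Rightarrow> int) \<Rightarrow> int poly" where
  "seq_poly N s = (\<Sum>i<N. Polynomial.monom (s i) i)"

definition two_adic_complexity :: "nat \<Rightarrow> (nat \<Rightarrow> int) \<Rightarrow> int" where
  "two_adic_complexity N s =
     \<lfloor>log 2 (real_of_int (2 ^ N - 1) /
             real_of_int (gcd (2 ^ N - 1) (poly (seq_poly N s) 2)))\<rfloor>"

end

theory Submission
  imports Defs
begin

text \<open>
  Since \<open>x \<equiv> 1\<close> modulo \<open>q\<close>, membership in \<open>D\<^sub>0\<close> or \<open>D\<^sub>1\<close> depends only on the quadratic character
  \<open>\<chi>\<close> modulo \<open>q\<close>.  Hence \<open>2 s\<^sub>i = 1 - \<chi>(i) + [q | i]\<close> for \<open>i\<close> prime to \<open>p\<close> (and \<open>s\<^sub>i = 0\<close> otherwise),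
  and \<open>2 S(2)\<close> is a combination of geometric sums and of the quadratic Gauss sums
  \<open>G(y) = \<Sum>j<q. \<chi>(j) y\<^sup>j\<close> at \<open>y = 2\<close> and \<open>y = 2\<^sup>p\<close>.

  Let \<open>r\<close> be a prime dividing both \<open>2\<^sup>N - 1\<close> and \<open>S(2)\<close>; all sums are taken modulo \<open>r\<close>.
  If \<open>2\<^sup>p \<equiv> 1\<close>, then \<open>2 S(2) \<equiv> -(q + 1)\<close>, while \<open>r \<equiv> 1\<close> modulo \<open>p\<close> forces \<open>r > 2 p\<close>, a contradiction
  since \<open>q + 1 = p + 3\<close>.  Otherwise \<open>G(y)\<^sup>2 \<equiv> 1\<close> for \<open>y = 2\<close> or \<open>y = 2\<^sup>p\<close>, where \<open>y\<^sup>q\<close> is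
  congruent to 1 and \<open>y\<close> is not; so \<open>r\<close> divides \<open>q - 1\<close> or \<open>q + 1\<close> by \<open>G(y)\<^sup>2 \<equiv> \<chi>(-1) q\<close>,
  while \<open>r \<equiv> 1\<close> modulo \<open>q\<close> forces \<open>r > 2 q\<close>.
\<close>

section \<open>The Legendre symbol modulo an odd prime\<close>

lemma odd_prime_gt_2:
  fixes p :: nat
  assumes "prime p" "odd p"
  shows "p > 2"
  using prime_ge_2_nat[OF assms(1)] assms(2) by (cases "p = 2") auto

lemma Legendre_cong:
  assumes "[a = b] (mod m)"
  shows "Legendre a m = Legendre b m"
proof -
  have "[c = a] (mod m) \<longleftrightarrow> [c = b] (mod m)" for c
    using assms by (metis cong_sym cong_trans)
  moreover have "[a = 0] (mod m) \<longleftrightarrow> [b = 0] (mod m)"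
    using assms by (metis cong_sym cong_trans)
  ultimately show ?thesis by (simp add: Legendre_def QuadRes_def)
qed

text \<open>Euler's criterion gives the congruence modulo \<open>q\<close>. Both sides lie in {-1,
  0, 1}, so they differ by at most 2 < \<open>q\<close> and must be equal.\<close>

lemma Legendre_mult:
  fixes q :: nat
  assumes "prime q" "q > 2"
  shows "Legendre (a * b) q = Legendre a q * Legendre b q"
proof -
  have "[Legendre (a * b) q = Legendre a q * Legendre b q] (mod q)"
    using euler_criterion[OF assms, of "a * b"]
      cong_mult[OF euler_criterion[OF assms, of a] euler_criterion[OF assms, of b]]
    by (metis cong_sym cong_trans power_mult_distrib)
  moreover have "Legendre c q \<in> {-1, 0, 1}" for c
    by (simp add: Legendre_def)
  then have "Legendre a q \<in> {-1, 0, 1}" "Legendre b q \<in> {-1, 0, 1}" "Legendre (a * b) q \<in> {-1, 0, 1}"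
    by blast+
  then have "\<bar>Legendre (a * b) q - Legendre a q * Legendre b q\<bar> < int q"
    using assms(2) by auto
  ultimately show ?thesis
    by (metis cong_iff_dvd_diff zdvd_imp_le zero_less_abs_iff dvd_abs_iff not_le eq_iff_diff_eq_0)
qed

lemma Legendre_int_eq_0_iff: "Legendre (int a) (int q) = 0 \<longleftrightarrow> q dvd a"
  by (auto simp: Legendre_def cong_0_iff)

lemma Legendre_int_square:
  "\<not> q dvd a \<Longrightarrow> Legendre (int a) (int q) * Legendre (int a) (int q) = 1"
  by (auto simp: Legendre_def cong_0_iff)

lemma int_primroot_residue:
  assumes "prime p" "int_primroot p g"
  obtains h where "residue_primroot p h" "[int h = g] (mod int p)" "\<not> p dvd h"
proof
  define h where "h = nat (g mod int p)"
  show h: "residue_primroot p h" using assms(2) by (simp add: int_primroot_def h_def)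
  show "[int h = g] (mod int p)" using assms(1) by (simp add: h_def prime_gt_0_nat)
  show "\<not> p dvd h"
    using h assms by (metis coprime_absorb_left not_prime_unit residue_primroot_def)
qed

text \<open>Were a primitive root a square, Euler's criterion would make its order divide (q - 1) /
  2, whereas that order is q - 1.\<close>

lemma Legendre_primroot:
  assumes "prime q" "q > 2" "int_primroot q g"
  shows "Legendre g q = -1"
proof -
  obtain h where h: "residue_primroot q h" "[int h = g] (mod int q)" "\<not> q dvd h"
    using int_primroot_residue[OF assms(1,3)] by blast
  have "Legendre (int h) q \<noteq> 0" using h(3) by (simp add: Legendre_int_eq_0_iff)
  moreover have "Legendre (int h) q \<noteq> 1"
  proof
    assume "Legendre (int h) q = 1"
    then have "[int h ^ ((q - 1) div 2) = 1] (mod q)"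
      using euler_criterion[OF assms(1,2), of "int h"] by (simp add: cong_sym)
    then have "[h ^ ((q - 1) div 2) = 1] (mod q)"
      by (metis cong_int_iff of_nat_1 of_nat_power)
    then have "q - 1 dvd (q - 1) div 2"
      using h(1) assms(1) by (simp add: ord_divides' residue_primroot_def totient_prime)
    moreover have "(q - 1) div 2 > 0" "(q - 1) div 2 < q - 1" using assms(2) by auto
    ultimately show False using nat_dvd_not_less by blast
  qed
  ultimately have "Legendre (int h) q = -1" by (simp add: Legendre_def split: if_splits)
  moreover have "Legendre (int h) q = Legendre g q"
    by (rule Legendre_cong[OF h(2)])
  ultimately show ?thesis by simp
qed

section \<open>Powers of an integer and geometric sums modulo \<open>r\<close>\<close>

lemma cong_pow_mod_exponent:
  fixes y r :: int
  assumes "[y ^ q = 1] (mod r)"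
  shows "[y ^ (i mod q) = y ^ i] (mod r)"
proof -
  have "[y ^ (i mod q) * (y ^ q) ^ (i div q) = y ^ (i mod q) * 1 ^ (i div q)] (mod r)"
    using assms by (intro cong_mult cong_pow) auto
  moreover have "y ^ (i mod q) * (y ^ q) ^ (i div q) = y ^ i"
    by (simp flip: power_add power_mult)
  ultimately show ?thesis by (simp add: cong_sym)
qed

text \<open>If \<open>k\<close> inverts \<open>m\<close> modulo \<open>q\<close>, then y \<equiv>
  y^(m k) = (y^m)^k \<equiv> 1.\<close>

lemma cong_1_if_coprime_exponents:
  fixes y r :: int
  assumes "[y ^ q = 1] (mod r)" "[y ^ m = 1] (mod r)" "coprime m q"
  shows "[y = 1] (mod r)"
proof -
  obtain k where k: "[m * k = Suc 0] (mod q)"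
    using cong_solve_coprime_nat[OF assms(3)] by blast
  have "[y ^ 1 = y ^ (1 mod q)] (mod r)"
    by (rule cong_sym, rule cong_pow_mod_exponent[OF assms(1)])
  also have "1 mod q = (m * k) mod q" using k by (simp add: cong_def)
  also have "[y ^ (m * k mod q) = y ^ (m * k)] (mod r)"
    by (rule cong_pow_mod_exponent[OF assms(1)])
  also have "y ^ (m * k) = (y ^ m) ^ k" by (simp add: power_mult)
  also have "[(y ^ m) ^ k = 1 ^ k] (mod r)"
    using assms(2) by (rule cong_pow)
  finally show ?thesis by simp
qed

text \<open>Here \<open>y\<close> has order exactly \<open>q\<close> modulo \<open>r\<close>. If
  \<open>q\<close> did not divide r - 1, the exponents \<open>q\<close> and r - 1 (by Fermat) would
  be coprime and force y \<equiv> 1.\<close>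

lemma prime_dvd_pred_if_cong_1:
  fixes y q r :: nat
  assumes "prime q" "prime r" "[int y ^ q = 1] (mod int r)" "\<not> [int y = 1] (mod int r)"
  shows "q dvd r - 1"
proof (rule ccontr)
  assume "\<not> q dvd r - 1"
  then have cop: "coprime (r - 1) q"
    using assms(1) by (simp add: coprime_commute prime_imp_coprime)
  have "\<not> r dvd y"
  proof
    assume "r dvd y"
    then have "int r dvd int y ^ q"
      using assms(1) by (simp add: dvd_power_le[of _ _ 1, simplified] prime_gt_0_nat Suc_leI
          dvd_trans[OF _ dvd_power])
    then have "int r dvd 1"
      using assms(3) by (metis cong_dvd_iff)
    then show False using assms(2) by auto
  qed
  then have "[y ^ (r - 1) = 1] (mod r)" using assms(2) by (intro fermat_theorem)
  then have "[int y ^ (r - 1) = 1] (mod int r)"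
    by (metis cong_int_iff of_nat_1 of_nat_power)
  then show False
    using cong_1_if_coprime_exponents[OF assms(3) _ cop] assms(4) by blast
qed

lemma cong_geometric_sum_0:
  fixes y r :: int
  assumes "prime r" "[y ^ n = 1] (mod r)" "\<not> [y = 1] (mod r)"
  shows "[(\<Sum>j<n. y ^ j) = 0] (mod r)"
proof -
  have "r dvd (y - 1) * (\<Sum>j<n. y ^ j)"
    using assms(2) by (simp add: cong_iff_dvd_diff flip: power_diff_1_eq)
  then show ?thesis
    using assms(1,3) by (auto simp: prime_dvd_mult_iff cong_iff_dvd_diff)
qed

text \<open>Multiplication by \<open>a\<close> permutes the residues modulo \<open>q\<close>.
  Periodicity of \<open>f\<close> is asked only modulo \<open>r\<close> because the powers of
  \<open>y\<close> repeat only there; for r = 0 the congruence is an equality.\<close>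

lemma cong_sum_mult_residues:
  fixes f :: "nat \<Rightarrow> int"
  assumes "coprime a q" "\<And>i. [f (i mod q) = f i] (mod r)"
  shows "[(\<Sum>j<q. f (a * j)) = (\<Sum>j<q. f j)] (mod r)"
proof -
  have inj: "inj_on (\<lambda>j. a * j mod q) {..<q}"
    using assms(1) by (auto intro!: inj_onI simp: cong_mult_lcancel_nat simp flip: cong_def)
       (auto simp: cong_def)
  moreover have sub: "(\<lambda>j. a * j mod q) ` {..<q} \<subseteq> {..<q}"
    by auto
  ultimately have "bij_betw (\<lambda>j. a * j mod q) {..<q} {..<q}"
    by (simp add: bij_betw_def endo_inj_surj)
  then have "(\<Sum>j<q. f (a * j mod q)) = (\<Sum>j<q. f j)"
    by (rule sum.reindex_bij_betw)
  then show ?thesis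
    using cong_sum[of "{..<q}" "\<lambda>j. f (a * j mod q)" "\<lambda>j. f (a * j)" r] assms(2)
    by (simp add: cong_sym)
qed

section \<open>Character sums and quadratic Gauss sums\<close>

lemma Legendre_int_mod: "Legendre (int (i mod q)) (int q) = Legendre (int i) (int q)"
  by (rule Legendre_cong) (simp add: of_nat_mod)

text \<open>Replacing \<open>j\<close> by g j for a primitive root \<open>g\<close> permutes the
  terms and changes the sign of the sum.\<close>

lemma sum_Legendre:
  assumes "prime q" "q > 2"
  shows "(\<Sum>j<q. Legendre (int j) (int q)) = 0"
proof -
  obtain g where g: "residue_primroot q g"
    using prime_primitive_root_exists[of q] assms by (auto simp: residue_primroot_def)
  then have "int_primroot q (int g)"
    by (simp add: int_primroot_def nat_int flip: of_nat_mod)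
  then have m1: "Legendre (int g) (int q) = -1"
    using assms by (intro Legendre_primroot)
  \<comment> \<open>Modulus 0 turns the congruence into an equality of integers.\<close>
  have "[(\<Sum>j<q. Legendre (int (g * j)) q) = (\<Sum>j<q. Legendre (int j) q)] (mod 0)"
    using g by (intro cong_sum_mult_residues)
      (auto simp: residue_primroot_def coprime_commute Legendre_int_mod)
  then show ?thesis
    using m1 by (simp add: Legendre_mult[OF assms] sum_negf)
qed

text \<open>The quadratic Gauss sum with an integer \<open>y\<close> in place of a complex root of
  unity; it behaves like one modulo any \<open>r\<close> with y^q \<equiv> 1.\<close>

definition gauss_sum :: "nat \<Rightarrow> int \<Rightarrow> int" where
  "gauss_sum q y = (\<Sum>j<q. Legendre (int j) (int q) * y ^ j)"

text \<open>Substitute a j for \<open>j\<close> in the sum and use multiplicativity of the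
  symbol.\<close>

lemma gauss_sum_mult_exponent:
  assumes "prime q" "q > 2" "[y ^ q = 1] (mod r)" "\<not> q dvd a"
  shows "[Legendre (int a) q * gauss_sum q (y ^ a) = gauss_sum q y] (mod r)"
proof -
  have "coprime a q" using assms(1,4) by (metis prime_imp_coprime coprime_commute)
  then have "[(\<Sum>j<q. Legendre (int (a * j)) q * y ^ (a * j)) =
      (\<Sum>j<q. Legendre (int j) q * y ^ j)] (mod r)"
    using assms by (intro cong_sum_mult_residues)
      (auto simp: Legendre_int_mod intro!: cong_mult cong_pow_mod_exponent)
  then show ?thesis
    by (simp add: gauss_sum_def Legendre_mult[OF assms(1,2)] sum_distrib_left power_mult mult.assoc)
qed

text \<open>The classical evaluation of the squared Gauss sum, carried out modulo \<open>r\<close>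
  with \<open>y\<close> as a primitive \<open>q\<close>-th root of unity.\<close>

lemma gauss_sum_square:
  fixes y r :: int
  assumes "prime q" "q > 2" "prime r" "[y ^ q = 1] (mod r)" "\<not> [y = 1] (mod r)"
  shows "[(gauss_sum q y)\<^sup>2 = Legendre (-1) q * int q] (mod r)"
proof -
  let ?L = "\<lambda>j. Legendre (int j) (int q)"
  have q0: "{..<q} = insert 0 {1..<q}" using assms(2) by auto
  have "(gauss_sum q y)\<^sup>2 = (\<Sum>a<q. ?L a * y ^ a * gauss_sum q y)"
    by (simp add: power2_eq_square gauss_sum_def sum_distrib_right)
  also have "\<dots> = (\<Sum>a\<in>{1..<q}. ?L a * y ^ a * gauss_sum q y)"
    by (simp add: q0 Legendre_def)
  \<comment> \<open>One factor G(y) is rewritten as \<chi>(a) G(y^a), so that \<chi>(a) appears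
    squared and cancels.\<close>
  also have "[\<dots> = (\<Sum>a\<in>{1..<q}. ?L a * y ^ a * (?L a * gauss_sum q (y ^ a)))] (mod r)"
  proof (intro cong_sum cong_mult cong_refl)
    fix a assume "a \<in> {1..<q}"
    then have "\<not> q dvd a" by (auto dest: dvd_imp_le)
    then show "[gauss_sum q y = ?L a * gauss_sum q (y ^ a)] (mod r)"
      using gauss_sum_mult_exponent[OF assms(1,2,4)] by (simp add: cong_sym)
  qed
  also have "(\<Sum>a\<in>{1..<q}. ?L a * y ^ a * (?L a * gauss_sum q (y ^ a)))
      = (\<Sum>a\<in>{1..<q}. y ^ a * gauss_sum q (y ^ a))"
  proof (intro sum.cong refl)
    fix a assume "a \<in> {1..<q}"
    then have "?L a * ?L a = 1" by (intro Legendre_int_square) (auto dest: dvd_imp_le)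
    then show "?L a * y ^ a * (?L a * gauss_sum q (y ^ a)) = y ^ a * gauss_sum q (y ^ a)"
      by (metis (no_types, lifting) mult.assoc mult.commute mult_1)
  qed
  also have "\<dots> = (\<Sum>a\<in>{1..<q}. \<Sum>c<q. ?L c * (y ^ Suc c) ^ a)"
    unfolding gauss_sum_def sum_distrib_left
    by (intro sum.cong refl) (simp add: power_mult_distrib power_mult[symmetric] mult.commute)
  also have "\<dots> = (\<Sum>c<q. ?L c * (\<Sum>a\<in>{1..<q}. (y ^ Suc c) ^ a))"
    unfolding sum_distrib_left by (rule sum.swap)
  \<comment> \<open>The inner sum is a full geometric sum without its term 1 at a = 0. The full sum
    is \<open>q\<close> when c + 1 = q, where y^(c+1) \<equiv> 1, and vanishes otherwise.\<close>
  also have "[\<dots> = (\<Sum>c<q. ?L c * ((if c = q - 1 then int q else 0) - 1))] (mod r)"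
  proof (intro cong_sum cong_mult cong_refl)
    fix c assume c: "c \<in> {..<q}"
    have split: "(\<Sum>a\<in>{1..<q}. z ^ a) = (\<Sum>a<q. z ^ a) - 1" for z :: int
      by (simp add: q0)
    have yq: "[(y ^ Suc c) ^ q = 1] (mod r)"
      using cong_pow[OF assms(4), of "Suc c"] by (metis power_mult power_one mult.commute)
    have "[(\<Sum>a<q. (y ^ Suc c) ^ a) = (if c = q - 1 then int q else 0)] (mod r)"
    proof (cases "c = q - 1")
      case True
      then have "[y ^ Suc c = 1] (mod r)" using assms by simp
      then have "[(\<Sum>a<q. (y ^ Suc c) ^ a) = (\<Sum>a<q. 1 ^ a)] (mod r)"
        by (intro cong_sum cong_pow)
      then show ?thesis using True by simp
    next
      case False
      then have "\<not> q dvd Suc c" using c by (auto dest: dvd_imp_le)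
      then have "coprime (Suc c) q" using assms by (simp add: coprime_commute prime_imp_coprime)
      then have "\<not> [y ^ Suc c = 1] (mod r)"
        using cong_1_if_coprime_exponents[OF assms(4)] assms(5) by blast
      then show ?thesis using False cong_geometric_sum_0[OF assms(3) yq] by simp
    qed
    then show "[(\<Sum>a\<in>{1..<q}. (y ^ Suc c) ^ a) = (if c = q - 1 then int q else 0) - 1] (mod r)"
      unfolding split by (intro cong_diff cong_refl)
  qed
  \<comment> \<open>The contributions of -1 cancel because the character sums to 0.\<close>
  also have "(\<Sum>c<q. ?L c * ((if c = q - 1 then int q else 0) - 1)) = ?L (q - 1) * int q"
    using sum_Legendre[OF assms(1,2)] assms(2)
    by (simp add: right_diff_distrib sum_subtractf if_distrib[of "(*) _"] cong: if_cong)
  also have "?L (q - 1) = Legendre (-1) q"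
    using assms(2) by (intro Legendre_cong) (simp add: cong_iff_dvd_diff of_nat_diff)
  finally show ?thesis .
qed

section \<open>Primitive roots and membership in the cyclotomic classes\<close>

lemma int_primroot_not_dvd:
  assumes "prime p" "int_primroot p g"
  shows "\<not> int p dvd g"
proof -
  obtain h where h: "[int h = g] (mod int p)" "\<not> p dvd h"
    using int_primroot_residue[OF assms] by blast
  then show ?thesis using cong_dvd_iff[OF h(1)] by simp
qed

lemma int_primroot_power_cong:
  assumes "prime p" "int_primroot p g" "[m = n] (mod p - 1)"
  shows "[g ^ m = g ^ n] (mod int p)"
proof -
  obtain h where h: "[int h = g] (mod int p)" "\<not> p dvd h"
    using int_primroot_residue[OF assms(1,2)] by blast
  have "[h ^ (p - 1) = 1] (mod p)" by (rule fermat_theorem[OF assms(1) h(2)])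
  then have "[int h ^ (p - 1) = 1] (mod int p)"
    by (metis cong_int_iff of_nat_1 of_nat_power)
  then have *: "[g ^ (p - 1) = 1] (mod int p)"
    using cong_pow[OF h(1), of "p - 1"] by (metis cong_sym cong_trans)
  show ?thesis
    using cong_pow_mod_exponent[OF *, of m] cong_pow_mod_exponent[OF *, of n] assms(3)
    unfolding cong_def by metis
qed

lemma int_primroot_generates:
  assumes "prime p" "int_primroot p g" "\<not> int p dvd a"
  obtains k where "[a = g ^ k] (mod int p)"
proof -
  obtain h where h: "residue_primroot p h" "[int h = g] (mod int p)"
    using int_primroot_residue[OF assms(1,2)] by blast
  define b where "b = nat (a mod int p)"
  have p0: "p > 0" "p > 1" using prime_gt_1_nat[OF assms(1)] by auto
  have ba: "[int b = a] (mod int p)" using p0 by (simp add: b_def)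
  have "\<not> p dvd b" using ba assms(3) by (metis cong_dvd_iff of_nat_dvd_iff)
  moreover have "b < p" using p0 by (simp add: b_def nat_less_iff)
  ultimately have "b \<in> totatives p"
    using assms(1) by (cases "b = 0") (auto simp: totatives_prime)
  then have "b \<in> (\<lambda>i. h ^ i mod p) ` {..<totient p}"
    using residue_primroot_is_generator[OF p0(2) h(1)] by (simp add: bij_betw_def)
  then obtain k where "b = h ^ k mod p" by blast
  then have "[b = h ^ k] (mod p)" by simp
  then have "[int b = int h ^ k] (mod int p)" by (metis cong_int_iff of_nat_power)
  then have "[a = g ^ k] (mod int p)"
    using ba cong_pow[OF h(2), of k] by (metis cong_sym cong_trans)
  then show thesis by (rule that)
qed

text \<open>Write i \<equiv> g^a modulo \<open>p\<close> and i \<equiv> g^(2c) modulo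
  \<open>q\<close>, the latter exponent being even since \<open>i\<close> is a square. It remains to
  match g^(2t) x^k with both; coprimality of the halves, that is gcd(p - 1, q - 1) = 2, lets one
  \<open>t\<close> serve both moduli.\<close>

lemma mem_dh_D0:
  assumes "prime p" "odd p" "prime q" "odd q" "p \<noteq> q" "coprime ((p - 1) div 2) ((q - 1) div 2)"
    and g: "int_primroot p g" "int_primroot q g"
    and x: "[x = g] (mod int p)" "[x = 1] (mod int q)"
    and i: "i < p * q" "\<not> p dvd i" "Legendre (int i) (int q) = 1"
  shows "int i \<in> dh_D0 p q g x"
proof -
  obtain a where a: "[int i = g ^ a] (mod int p)"
    using int_primroot_generates[OF assms(1) g(1), of "int i"] i(2) by auto
  have nq: "\<not> int q dvd int i" and "QuadRes q i"
    using i(3) by (auto simp: Legendre_def cong_0_iff split: if_splits)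
  then obtain y where y: "[y\<^sup>2 = int i] (mod int q)" by (auto simp: QuadRes_def)
  then have "\<not> int q dvd y" using nq
    by (metis cong_dvd_iff dvd_mult2 power2_eq_square)
  then obtain c where "[y = g ^ c] (mod int q)"
    using int_primroot_generates[OF assms(3) g(2)] by blast
  then have c: "[int i = g ^ (2 * c)] (mod int q)"
    using y cong_pow[of y "g ^ c" "int q" 2] by (metis cong_sym cong_trans power_mult mult.commute)
  \<comment> \<open>As \<open>x\<close> is \<open>g\<close> modulo \<open>p\<close> and 1 modulo
    \<open>q\<close>, the factor x^k corrects the parity of the exponent modulo \<open>p\<close>
    without disturbing the residue modulo \<open>q\<close>.\<close>
  define k where "k = a mod 2"
  have pq: "p > 2" "q > 2" using assms(1-4) by (auto intro: odd_prime_gt_2)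
  have halves: "p - 1 = 2 * ((p - 1) div 2)" "q - 1 = 2 * ((q - 1) div 2)"
    using assms(2,4) by auto
  obtain t where t: "t < ((p - 1) div 2) * ((q - 1) div 2)" "[t = a div 2] (mod ((p - 1) div 2))"
      "[t = c] (mod ((q - 1) div 2))"
    using binary_chinese_remainder_unique_nat[OF assms(6), of "a div 2" c] pq by auto
  \<comment> \<open>The range of \<open>t\<close> in \<open>dh_D0\<close> is exactly the range of
    the Chinese remainder solution.\<close>
  have "dh_e p q div 2 = ((p - 1) div 2) * ((q - 1) div 2)"
    unfolding dh_e_def by (subst halves(1), subst halves(2)) simp
  then have t_less: "t < dh_e p q div 2" using t(1) by simp
  have "[2 * t = 2 * (a div 2)] (mod (2 * ((p - 1) div 2)))" "[2 * t = 2 * c] (mod (2 * ((q - 1) div 2)))"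
    using t(2,3) unfolding cong_def mod_mult_mult1 by simp_all
  then have "[2 * t = 2 * (a div 2)] (mod (p - 1))" "[2 * t = 2 * c] (mod (q - 1))"
    unfolding halves[symmetric] .
  then have 1: "[2 * t + k = a] (mod (p - 1))" and 2: "[2 * t = 2 * c] (mod (q - 1))"
    using cong_add[of "2 * t" "2 * (a div 2)" "p - 1" k k] by (auto simp: k_def)
  have "[g ^ (2 * t) * x ^ k = g ^ (2 * t) * g ^ k] (mod int p)"
    by (intro cong_mult cong_pow x(1) cong_refl)
  also have "g ^ (2 * t) * g ^ k = g ^ (2 * t + k)" by (simp add: power_add)
  also have "[\<dots> = g ^ a] (mod int p)" by (rule int_primroot_power_cong[OF assms(1) g(1) 1])
  finally have modp: "[g ^ (2 * t) * x ^ k = int i] (mod int p)"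
    using a by (metis cong_sym cong_trans)
  have "[g ^ (2 * t) * x ^ k = g ^ (2 * t) * 1 ^ k] (mod int q)"
    by (intro cong_mult cong_pow x(2) cong_refl)
  also have "g ^ (2 * t) * 1 ^ k = g ^ (2 * t)" by simp
  also have "[\<dots> = g ^ (2 * c)] (mod int q)" by (rule int_primroot_power_cong[OF assms(3) g(2) 2])
  finally have modq: "[g ^ (2 * t) * x ^ k = int i] (mod int q)"
    using c by (metis cong_sym cong_trans)
  have "coprime (int p) (int q)" using assms(1,3,5) by (simp add: primes_coprime)
  then have "[g ^ (2 * t) * x ^ k = int i] (mod int p * int q)"
    using modp modq by (intro coprime_cong_mult)
  then have "int i = (g ^ (2 * t) * x ^ k) mod int (p * q)"
    using i(1) by (simp add: cong_def flip: of_nat_mult of_nat_mod)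
  moreover have "k \<in> {0, 1}" by (auto simp: k_def)
  ultimately show ?thesis using t_less unfolding dh_D0_def by blast
qed

text \<open>Dividing \<open>i\<close> by \<open>g\<close> modulo p q gives a \<open>d\<close> of
  character 1, because \<open>g\<close> has character -1; so \<open>d\<close> lies in
  \<open>dh_D0\<close>.\<close>

lemma mem_dh_D1:
  assumes "prime p" "odd p" "prime q" "odd q" "p \<noteq> q" "coprime ((p - 1) div 2) ((q - 1) div 2)"
    and g: "int_primroot p g" "int_primroot q g"
    and x: "[x = g] (mod int p)" "[x = 1] (mod int q)"
    and i: "i < p * q" "\<not> p dvd i" "Legendre (int i) (int q) = -1"
  shows "int i \<in> dh_D1 p q g x"
proof -
  have q2: "q > 2" using assms(3,4) by (rule odd_prime_gt_2)
  have "coprime g (int p)" "coprime g (int q)"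
    using int_primroot_not_dvd assms(1,3) g
    by (metis prime_imp_coprime coprime_commute prime_nat_int_transfer)+
  then have "coprime g (int (p * q))" by simp
  then obtain z where z: "[g * z = 1] (mod int (p * q))"
    using cong_solve_coprime_int by blast
  define d where "d = nat (z * int i mod int (p * q))"
  have pq0: "p * q > 0" using i(1) by (rule le_less_trans[OF le0])
  have d: "int d = z * int i mod int (p * q)" using pq0 by (simp add: d_def)
  have "[g * int d = g * (z * int i)] (mod int (p * q))"
    unfolding d by (intro cong_mult cong_refl) simp
  also have "g * (z * int i) = (g * z) * int i" by simp
  also have "[\<dots> = 1 * int i] (mod int (p * q))" by (intro cong_mult z cong_refl)
  finally have gd: "[g * int d = int i] (mod int (p * q))" by simp
  then have "[g * int d = int i] (mod int p)" "[g * int d = int i] (mod int q)"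
    by (auto intro: cong_dvd_modulus)
  moreover have "Legendre g q = -1" using assms(3) q2 g(2) by (rule Legendre_primroot)
  ultimately have "Legendre (int d) q = 1" "\<not> p dvd d"
    using i(2,3) Legendre_mult[OF assms(3) q2, of g "int d"] Legendre_cong
    by (force, metis cong_dvd_iff dvd_mult of_nat_dvd_iff)
  moreover have "d < p * q" using pq0 d
    by (metis of_nat_0_less_iff of_nat_less_iff pos_mod_bound)
  ultimately have "int d \<in> dh_D0 p q g x" using assms by (intro mem_dh_D0)
  moreover have "int i = (g * int d) mod int (p * q)"
    using gd i(1) by (simp add: cong_def flip: of_nat_mult of_nat_mod)
  ultimately show ?thesis unfolding dh_D1_def by blast
qed

section \<open>Evaluation of the generating sum\<close>

text \<open>Twice the sequence value at an \<open>i\<close> prime to \<open>p\<close>; doubling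
  avoids fractions. At multiples of \<open>q\<close> the symbol is 0, and the last term raises the
  weight to 2, as s_i = 1 on \<open>dh_Q\<close> requires.\<close>

definition dh_weight :: "nat \<Rightarrow> nat \<Rightarrow> int" where
  "dh_weight q i = 1 - Legendre (int i) (int q) + of_bool (q dvd i)"

text \<open>The weight has period \<open>q\<close>, so writing i = b + k q splits the sum into a
  product.\<close>

lemma sum_dh_weight:
  "(\<Sum>i<p * q. dh_weight q i * z ^ i) = (\<Sum>b<q. dh_weight q b * z ^ b) * (\<Sum>k<p. (z ^ q) ^ k)"
proof -
  have w: "dh_weight q (j + k * q) = dh_weight q j" for j k
    by (auto simp: dh_weight_def cong_iff_dvd_diff intro!: Legendre_cong)
  have "(\<Sum>i<p * q. dh_weight q i * z ^ i) = (\<Sum>k<p. \<Sum>i\<in>{k * q..<k * q + q}. dh_weight q i * z ^ i)"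
    by (rule sum.nat_group[symmetric])
  also have "\<dots> = (\<Sum>k<p. \<Sum>b<q. dh_weight q b * z ^ b * (z ^ q) ^ k)"
  proof (rule sum.cong[OF refl])
    fix k
    have "(\<Sum>i\<in>{k * q..<k * q + q}. dh_weight q i * z ^ i)
        = (\<Sum>b\<in>{0..<q}. dh_weight q (b + k * q) * z ^ (b + k * q))"
      using sum.shift_bounds_nat_ivl[of "\<lambda>i. dh_weight q i * z ^ i" 0 "k * q" q]
      by (simp add: add.commute)
    then show "(\<Sum>i\<in>{k * q..<k * q + q}. dh_weight q i * z ^ i)
        = (\<Sum>b<q. dh_weight q b * z ^ b * (z ^ q) ^ k)"
      by (simp add: w power_add power_mult mult.commute[of k q] mult.assoc lessThan_atLeast0
          w[of _ k, unfolded mult.commute[of k q]])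
  qed
  finally show ?thesis
    by (simp add: sum_distrib_left sum_distrib_right sum.swap[of _ "{..<q}"])
qed

text \<open>The three terms of the weight are summed separately; among j < q only j = 0 makes a j
  divisible by \<open>q\<close>, which gives the final 1.\<close>

lemma sum_dh_weight_dilate:
  assumes "prime q" "q > 2" "\<not> q dvd a"
  shows "(\<Sum>j<q. dh_weight q (a * j) * y ^ j) = (\<Sum>j<q. y ^ j) - Legendre (int a) (int q) * gauss_sum q y + 1"
proof -
  have q0: "{..<q} = insert 0 {1..<q}" using assms(2) by auto
  have "(\<Sum>j<q. of_bool (q dvd a * j) * y ^ j) = (1::int)"
  proof -
    have "(\<Sum>j\<in>{1..<q}. of_bool (q dvd a * j) * y ^ j) = 0"
      using assms by (intro sum.neutral) (auto simp: prime_dvd_mult_iff dest: dvd_imp_le)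
    then show ?thesis by (simp add: q0)
  qed
  then show ?thesis
    by (simp add: dh_weight_def distrib_right left_diff_distrib sum.distrib sum_subtractf
        Legendre_mult[OF assms(1,2)] gauss_sum_def sum_distrib_left mult.assoc)
qed

lemma dh_sequence_value:
  fixes s :: "nat \<Rightarrow> int"
  assumes "prime p" "odd p" "prime q" "odd q" "p \<noteq> q" "coprime ((p - 1) div 2) ((q - 1) div 2)"
    and g: "int_primroot p g" "int_primroot q g"
    and x: "[x = g] (mod int p)" "[x = 1] (mod int q)"
    and s1: "\<And>i. int (i mod (p * q)) \<in> dh_D1 p q g x \<union> dh_Q p q \<Longrightarrow> s i = 1"
    and s0: "\<And>i. int (i mod (p * q)) \<in> dh_D0 p q g x \<union> dh_P p q \<union> {0} \<Longrightarrow> s i = 0"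
    and i: "i < p * q"
  shows "2 * s i = (if p dvd i then 0 else dh_weight q i)"
proof -
  have im: "int (i mod (p * q)) = int i" using i by simp
  consider "p dvd i" | "\<not> p dvd i" "q dvd i" | "\<not> p dvd i" "Legendre (int i) q = 1"
    | "\<not> p dvd i" "Legendre (int i) q = -1"
    by (metis Legendre_def Legendre_int_eq_0_iff)
  then show ?thesis
  proof cases
    case 1
    then obtain k where k: "i = k * p" by (metis dvdE mult.commute)
    then have "k < q" using i by (simp add: mult.commute)
    then have "i = 0 \<or> int i \<in> dh_P p q" unfolding dh_P_def k by (cases "k = 0") auto
    then have "int (i mod (p * q)) \<in> dh_D0 p q g x \<union> dh_P p q \<union> {0}" unfolding im by auto
    then show ?thesis using s0 1 by simp
  next
    case 2
    then obtain k where k: "i = k * q" by (metis dvdE mult.commute)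
    then have "k < p" "k \<noteq> 0" using i 2(1) by (auto intro: Nat.gr0I)
    then have "int i \<in> dh_Q p q" unfolding dh_Q_def k by auto
    then have "int (i mod (p * q)) \<in> dh_D1 p q g x \<union> dh_Q p q" unfolding im by auto
    then show ?thesis using s1 2 Legendre_int_eq_0_iff[of i q] by (simp add: dh_weight_def)
  next
    case 3
    then have "int (i mod (p * q)) \<in> dh_D0 p q g x \<union> dh_P p q \<union> {0}"
      unfolding im using mem_dh_D0[OF assms(1-10) i] by auto
    then show ?thesis using s0 3 Legendre_int_eq_0_iff[of i q] by (auto simp: dh_weight_def)
  next
    case 4
    then have "int (i mod (p * q)) \<in> dh_D1 p q g x \<union> dh_Q p q"
      unfolding im using mem_dh_D1[OF assms(1-10) i] by auto
    then show ?thesis using s1 4 Legendre_int_eq_0_iff[of i q] by (auto simp: dh_weight_def)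
  qed
qed

text \<open>Sum the weight over all \<open>i\<close> and subtract the multiples i = p j, where z^i =
  (z^p)^j. The first sum factors by periodicity, the second is dilated by \<open>p\<close>.\<close>

lemma dh_sum_eq:
  fixes s :: "nat \<Rightarrow> int"
  assumes "prime q" "q > 2" "p > 0" "\<not> q dvd p"
    and "\<And>i. i < p * q \<Longrightarrow> 2 * s i = (if p dvd i then 0 else dh_weight q i)"
  shows "2 * (\<Sum>i<p * q. s i * z ^ i) =
    ((\<Sum>b<q. z ^ b) - gauss_sum q z + 1) * (\<Sum>k<p. (z ^ q) ^ k)
    - ((\<Sum>j<q. (z ^ p) ^ j) - Legendre (int p) (int q) * gauss_sum q (z ^ p) + 1)"
proof -
  have "2 * (\<Sum>i<p * q. s i * z ^ i) = (\<Sum>i<p * q. (if p dvd i then 0 else dh_weight q i) * z ^ i)"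
    unfolding sum_distrib_left using assms(5) by (intro sum.cong) (auto simp flip: mult.assoc)
  also have "\<dots> = (\<Sum>i<p * q. dh_weight q i * z ^ i - (if p dvd i then dh_weight q i * z ^ i else 0))"
    by (intro sum.cong) auto
  also have "\<dots> = (\<Sum>i<p * q. dh_weight q i * z ^ i)
      - (\<Sum>i | i < p * q \<and> p dvd i. dh_weight q i * z ^ i)"
    by (simp add: sum_subtractf sum.If_cases Collect_conj_eq lessThan_def)
  also have "{i. i < p * q \<and> p dvd i} = (*) p ` {..<q}"
    using assms(3) by (auto elim!: dvdE)
  also have "(\<Sum>i\<in>(*) p ` {..<q}. dh_weight q i * z ^ i) = (\<Sum>j<q. dh_weight q (p * j) * (z ^ p) ^ j)"
    using assms(3) by (subst sum.reindex) (auto intro!: inj_onI simp: power_mult)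
  also have "\<dots> = (\<Sum>j<q. (z ^ p) ^ j) - Legendre (int p) (int q) * gauss_sum q (z ^ p) + 1"
    using assms by (intro sum_dh_weight_dilate)
  also have "(\<Sum>i<p * q. dh_weight q i * z ^ i)
      = (\<Sum>b<q. dh_weight q (1 * b) * z ^ b) * (\<Sum>k<p. (z ^ q) ^ k)"
    by (simp add: sum_dh_weight)
  also have "(\<Sum>b<q. dh_weight q (1 * b) * z ^ b)
      = (\<Sum>j<q. z ^ j) - Legendre (int 1) (int q) * gauss_sum q z + 1"
    using assms(1,2) by (intro sum_dh_weight_dilate) auto
  also have "Legendre (int 1) (int q) = 1"
    using assms(2) by (auto simp: Legendre_def QuadRes_def cong_0_iff intro!: exI[of _ 1])
  finally show ?thesis by simp
qed

section \<open>Absence of a common prime factor\<close>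

text \<open>The number r - 1 is even and positive, so it is at least twice its odd divisor
  \<open>p\<close>.\<close>

lemma odd_gt_double_if_dvd_pred:
  fixes p r :: nat
  assumes "odd p" "odd r" "r > 1" "p dvd r - 1"
  shows "r > 2 * p"
proof -
  obtain m where m: "r - 1 = p * m" using assms(4) by auto
  have "even (p * m)" unfolding m[symmetric] using assms(2,3) by simp
  then have "even m" using assms(1) by simp
  moreover have "m \<noteq> 0" using m assms(3) by (intro notI) simp
  ultimately have "m \<ge> 2" by auto
  then have "p * 2 \<le> p * m" by (rule mult_le_mono2)
  then show ?thesis using m assms(3) by linarith
qed

text \<open>The square is \<chi>(-1) q, so a value 1 would make \<open>r\<close> divide q - 1 or q +
  1, both positive and below 2 q < r.\<close>

lemma gauss_sum_square_not_1:
  fixes q r y :: nat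
  assumes "prime q" "odd q" "prime r" "odd r"
    and "[int y ^ q = 1] (mod int r)" "\<not> [int y = 1] (mod int r)"
  shows "\<not> [(gauss_sum q (int y))\<^sup>2 = 1] (mod int r)"
proof
  assume a: "[(gauss_sum q (int y))\<^sup>2 = 1] (mod int r)"
  have q2: "q > 2" using assms(1,2) by (rule odd_prime_gt_2)
  have r: "r > 2 * q" using prime_dvd_pred_if_cong_1[OF assms(1,3,5,6)] assms
    by (intro odd_gt_double_if_dvd_pred) (auto dest: prime_gt_1_nat)
  have "[(gauss_sum q (int y))\<^sup>2 = Legendre (-1) q * int q] (mod int r)"
    using assms q2 by (intro gauss_sum_square) auto
  then have "[Legendre (-1) q * int q = 1] (mod int r)"
    using a by (metis cong_sym cong_trans)
  then have "int r dvd Legendre (-1) q * int q - 1" by (simp add: cong_iff_dvd_diff)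
  moreover have "Legendre (-1) q = 1 \<or> Legendre (-1) q = -1"
    using q2 by (auto simp: Legendre_def cong_0_iff)
  ultimately have "int r dvd int q - 1 \<or> int r dvd int q + 1"
    by (metis minus_diff_eq minus_add_distrib dvd_minus_iff mult_1 mult_minus1 diff_minus_eq_add
        uminus_add_conv_diff add.commute)
  then show False using r q2 zdvd_imp_le[of "int r" "int q - 1"] zdvd_imp_le[of "int r" "int q + 1"]
    by auto
qed

text \<open>Modulo a common prime factor \<open>r\<close>, the number 2 has order \<open>p\<close>,
  \<open>q\<close> or p q; the case split on 2^p and 2^q runs through these.\<close>

lemma dh_sum_coprime:
  fixes s :: "nat \<Rightarrow> int"
  assumes "prime p" "odd p" "prime q" "odd q" "q = p + 2"
    and "\<And>i. i < p * q \<Longrightarrow> 2 * s i = (if p dvd i then 0 else dh_weight q i)"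
  shows "coprime (2 ^ (p * q) - 1) (\<Sum>i<p * q. s i * 2 ^ i)"
proof (rule ccontr)
  let ?S = "\<Sum>i<p * q. s i * 2 ^ i"
  have N_pos: "p * q > 0" using assms(1,3) by (simp add: prime_gt_0_nat)
  assume "\<not> ?thesis"
  then obtain r' :: int where r': "prime r'" "r' dvd 2 ^ (p * q) - 1" "r' dvd ?S"
    using prime_divisor_exists[of "gcd (2 ^ (p * q) - 1) ?S"] N_pos
    by (auto simp: coprime_iff_gcd_eq_1)
  define r where "r = nat r'"
  have r_r': "r' = int r" using r' by (simp add: r_def prime_ge_0_int)
  have r: "prime r" "int r dvd 2 ^ (p * q) - 1" "int r dvd ?S"
    using r' unfolding r_r' by auto
  have p3: "p \<ge> 3" using odd_prime_gt_2[OF assms(1,2)] by simp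
  then have p0: "p > 0" by simp
  have "odd (2 ^ (p * q) - 1 :: int)" using p3 assms(5) by simp
  then have "odd r" using r(2) by (metis dvd_trans even_of_nat_iff)
  have N1: "[2 ^ (p * q) = 1] (mod int r)" using r(2) by (simp add: cong_iff_dvd_diff)
  have q2: "q > 2" and qp: "\<not> q dvd p" using p3 assms(5) by (auto dest: dvd_imp_le)
  have "coprime p q" using assms by (intro primes_coprime) auto
  have pq1: "[(2 ^ p) ^ q = 1] (mod int r)" "[(2 ^ q) ^ p = 1] (mod int r)"
    using N1 by (simp_all add: mult.commute flip: power_mult)
  have "\<not> [2 = 1] (mod int r)" using r(1) by (auto simp: cong_iff_dvd_diff)
  have S: "int r dvd ((\<Sum>b<q. 2 ^ b) - gauss_sum q 2 + 1) * (\<Sum>k<p. (2 ^ q) ^ k)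
    - ((\<Sum>j<q. (2 ^ p) ^ j) - Legendre (int p) (int q) * gauss_sum q (2 ^ p) + 1)"
    (is "int r dvd ?A * ?B - ?C")
    using dvd_mult[OF r(3), of 2] dh_sum_eq[OF assms(3) q2 p0 qp assms(6), of 2] by simp
  then have S: "[?A * ?B = ?C] (mod int r)" by (simp add: cong_iff_dvd_diff)
  have prime_int: "prime (int r)" using r(1) by simp
  show False
  proof (cases "[2 ^ p = 1] (mod int r)")
    case True
    then have nq: "\<not> [2 ^ q = 1] (mod int r)"
      using cong_1_if_coprime_exponents[of 2 q "int r" p] \<open>coprime p q\<close> \<open>\<not> [2 = 1] (mod int r)\<close>
      by blast
    have "[?A * ?B = ?A * 0] (mod int r)"
      by (intro cong_mult cong_refl cong_geometric_sum_0[OF prime_int pq1(2) nq])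
    then have AB: "[?A * ?B = 0] (mod int r)" by simp
    have "[(\<Sum>j<q. (2 ^ p) ^ j) = (\<Sum>j<q. 1 ^ j)] (mod int r)"
      by (intro cong_sum cong_pow True)
    then have geom: "[(\<Sum>j<q. (2 ^ p) ^ j) = int q] (mod int r)" by simp
    have "[gauss_sum q (2 ^ p) = gauss_sum q 1] (mod int r)"
      unfolding gauss_sum_def by (intro cong_sum cong_mult cong_refl cong_pow True)
    then have "[gauss_sum q (2 ^ p) = 0] (mod int r)"
      using sum_Legendre[OF assms(3) q2] by (simp add: gauss_sum_def)
    then have "[?C = int q - Legendre (int p) (int q) * 0 + 1] (mod int r)"
      by (intro cong_add cong_diff cong_mult cong_refl geom)
    then have "[int q + 1 = 0] (mod int r)"
      using cong_trans[OF cong_sym[OF AB] S] by (simp add: cong_def)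
    then have "int r dvd int q + 1" by (simp add: cong_0_iff)
    then have "r \<le> q + 1" using zdvd_imp_le by fastforce
    have "[int 2 ^ p = 1] (mod int r)" "\<not> [int 2 = 1] (mod int r)"
      using True \<open>\<not> [2 = 1] (mod int r)\<close> by auto
    from prime_dvd_pred_if_cong_1[OF assms(1) r(1) this] have "r > 2 * p"
      using assms(2) \<open>odd r\<close> r(1) by (intro odd_gt_double_if_dvd_pred) (auto dest: prime_gt_1_nat)
    \<comment> \<open>From 2 p < r \<le> q + 1 = p + 3 it would follow that p < 3.\<close>
    then show False using \<open>r \<le> q + 1\<close> assms(2,5) p3 \<open>odd r\<close> by presburger
  next
    case np: False
    have C: "[?C = 0 - Legendre (int p) (int q) * gauss_sum q (2 ^ p) + 1] (mod int r)"
      by (intro cong_add cong_diff cong_refl cong_geometric_sum_0[OF prime_int pq1(1) np])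
    show False
    proof (cases "[2 ^ q = 1] (mod int r)")
      \<comment> \<open>Order p q: \<open>?B\<close> vanishes, hence so does \<open>?C\<close>,
        which gives \<chi>(p) G(2^p) \<equiv> 1.\<close>
      case False
      have "[?A * ?B = ?A * 0] (mod int r)"
        by (intro cong_mult cong_refl cong_geometric_sum_0[OF prime_int pq1(2) False])
      then have "[?A * ?B = 0] (mod int r)" by simp
      from cong_trans[OF cong_sym[OF C] cong_trans[OF cong_sym[OF S] this]]
      have "[Legendre (int p) (int q) * gauss_sum q (2 ^ p) = 1] (mod int r)"
        by (simp add: cong_iff_dvd_diff dvd_diff_commute)
      from cong_pow[OF this, of 2]
      have "[(gauss_sum q (2 ^ p))\<^sup>2 = 1] (mod int r)"
        using Legendre_int_square[OF qp] by (simp add: power_mult_distrib flip: power2_eq_square)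
      then show False
        using gauss_sum_square_not_1[OF assms(3,4) r(1) \<open>odd r\<close>, of "2 ^ p"] pq1(1) np by simp
    next
      \<comment> \<open>Order \<open>q\<close>: \<open>?A\<close> and \<open>?C\<close> are both
        congruent to 1 - G(2) and \<open>?B\<close> to \<open>p\<close>, so (1 - G(2)) (p - 1)
        \<equiv> 0, where \<open>r\<close> is too large to divide p - 1.\<close>
      case True
      have two: "[int 2 ^ q = 1] (mod int r)" "\<not> [int 2 = 1] (mod int r)"
        using True \<open>\<not> [2 = 1] (mod int r)\<close> by auto
      have "r > 2 * q" using prime_dvd_pred_if_cong_1[OF assms(3) r(1) two] assms(4) \<open>odd r\<close> r(1)
        by (intro odd_gt_double_if_dvd_pred) (auto dest: prime_gt_1_nat)
      then have rp: "\<not> int r dvd int p - 1"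
        using assms(5) p3 zdvd_imp_le[of "int r" "int p - 1"] by auto
      have A: "[?A = 0 - gauss_sum q 2 + 1] (mod int r)"
        using True \<open>\<not> [2 = 1] (mod int r)\<close>
        by (intro cong_add cong_diff cong_refl cong_geometric_sum_0[OF prime_int])
      have "[?B = (\<Sum>k<p. 1 ^ k)] (mod int r)" by (intro cong_sum cong_pow True)
      then have B: "[?B = int p] (mod int r)" by simp
      have "[Legendre (int p) (int q) * gauss_sum q (2 ^ p) = gauss_sum q 2] (mod int r)"
        using gauss_sum_mult_exponent[OF assms(3) q2 True qp] .
      then have "[0 - Legendre (int p) (int q) * gauss_sum q (2 ^ p) + 1 = 0 - gauss_sum q 2 + 1] (mod int r)"
        by (intro cong_add cong_diff cong_refl)
      then have "[(0 - gauss_sum q 2 + 1) * int p = 0 - gauss_sum q 2 + 1] (mod int r)"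
        by (rule cong_trans[OF cong_trans[OF cong_sym[OF cong_mult[OF A B]] cong_trans[OF S C]]])
      then have "int r dvd (1 - gauss_sum q 2) * (int p - 1)"
        by (simp add: cong_iff_dvd_diff algebra_simps)
      then have "int r dvd 1 - gauss_sum q 2"
        using rp prime_int by (simp add: prime_dvd_mult_iff)
      then have "[gauss_sum q 2 = 1] (mod int r)"
        by (simp add: cong_iff_dvd_diff dvd_diff_commute)
      from cong_pow[OF this, of 2] show False
        using gauss_sum_square_not_1[OF assms(3,4) r(1) \<open>odd r\<close> two] by simp
    qed
  qed
qed

section \<open>The 2-adic complexity\<close>

theorem theorem4:
  fixes p q N :: nat and g x :: int and s :: "nat \<Rightarrow> int"
  assumes "prime p" and "odd p" and "prime q" and "odd q" and "q = p + 2"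
    and "N = p * q"
    and "int_primroot p g" and "int_primroot q g"
    and "[x = g] (mod int p)" and "[x = 1] (mod int q)"
    and "\<And>i. int (i mod N) \<in> dh_D1 p q g x \<union> dh_Q p q \<Longrightarrow> s i = 1"
    and "\<And>i. int (i mod N) \<in> dh_D0 p q g x \<union> dh_P p q \<union> {0} \<Longrightarrow> s i = 0"
  shows "two_adic_complexity N s = int N - 1"
proof -
  \<comment> \<open>Consecutive integers are coprime; this is where q = p + 2 yields gcd(p - 1, q -
    1) = 2.\<close>
  have "(q - 1) div 2 = Suc ((p - 1) div 2)" using assms(2,5) by (auto elim!: oddE)
  then have halves: "coprime ((p - 1) div 2) ((q - 1) div 2)" by simp
  have "2 * s i = (if p dvd i then 0 else dh_weight q i)" if "i < p * q" for i
    using assms that halves by (intro dh_sequence_value[where g = g and x = x]) auto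
  then have "coprime (2 ^ N - 1) (\<Sum>i<N. s i * 2 ^ i)"
    unfolding assms(6) using assms by (intro dh_sum_coprime)
  then have gcd1: "gcd (2 ^ N - 1) (poly (seq_poly N s) 2) = 1"
    by (simp add: seq_poly_def poly_sum poly_monom)
  have "N > 0" using assms by (simp add: prime_gt_0_nat)
  then have "(2::real) ^ N = 2 * 2 ^ (N - 1)" "(2::real) ^ (N - 1) \<ge> 1"
    by (simp_all flip: power_Suc)
  \<comment> \<open>With gcd 1 the quotient is 2^N - 1, and these bounds fix the floor of its
    logarithm at N - 1.\<close>
  then have "2 ^ (N - 1) \<le> (2::real) ^ N - 1" "(2::real) ^ N - 1 < 2 ^ N" by auto
  then have "\<lfloor>log 2 ((2::real) ^ N - 1)\<rfloor> = int (N - 1)"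
    using \<open>N > 0\<close> powr_realpow[of 2 N] powr_realpow[of 2 "N - 1"]
    by (subst floor_log_eq_powr_iff) (auto simp: of_nat_diff)
  then show ?thesis
    using gcd1 \<open>N > 0\<close> by (simp add: two_adic_complexity_def)
qed

end
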